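(* There exist infinitely many (pairwise non-isomorphic) finite groups $G$ such that the bipartite divisor graph $B(G)$ for the conjugacy class sizes of $G$ is the complete bipartite graph $K_{2,5}$.
   Context: For a finite group $G$ with centre $\mathbf{Z}(G)$, and $g\in G$, let $g^G$ denote the conjugacy class of $g$ in $G$ and $|g^G|$ its cardinality. The bipartite divisor graph $B(G)$ for the conjugacy class sizes of $G$ is the bipartite graph whose vertex set is the disjoint union of two parts: (i) the set $\{|g^G| : g\in G\setminus \mathbf{Z}(G)\}$ of conjugacy class sizes different from $1$; and (ii) the set of prime numbers dividing at least one element of the set in (i). A prime $p$ in part (ii) and a class size $n$ in part (i) are joined by an edge if and only if $\gcd(p,n)\neq 1$ (that is, $p$ divides $n$), and there are no other edges. $K_{m,n}$ denotes the complete bipartite graph with parts of sizes $m$ and $n$, and "$B(G)=K_{2,5}$" means that the graph $B(G)$ is isomorphic to $K_{2,5}$. *)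

theory Defs
  imports "HOL-Algebra.Group" "HOL-Computational_Algebra.Primes" "Graph_Theory.Kuratowski"
begin

definition conj_class :: "('a, 'm) monoid_scheme \<Rightarrow> 'a \<Rightarrow> 'a set" where
  "conj_class G g = {x \<otimes>\<^bsub>G\<^esub> g \<otimes>\<^bsub>G\<^esub> inv\<^bsub>G\<^esub> x | x. x \<in> carrier G}"

definition group_centre :: "('a, 'm) monoid_scheme \<Rightarrow> 'a set" where
  "group_centre G = {z \<in> carrier G. \<forall>x \<in> carrier G. z \<otimes>\<^bsub>G\<^esub> x = x \<otimes>\<^bsub>G\<^esub> z}"

definition noncentral_class_sizes :: "('a, 'm) monoid_scheme \<Rightarrow> nat set" where
  "noncentral_class_sizes G = {card (conj_class G g) | g. g \<in> carrier G - group_centre G}"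

definition class_size_primes :: "('a, 'm) monoid_scheme \<Rightarrow> nat set" where
  "class_size_primes G = {p. prime p \<and> (\<exists>n \<in> noncentral_class_sizes G. p dvd n)}"

text \<open>
  The vertex set is a disjoint union of two sets of naturals: class sizes are tagged with
  \<^const>\<open>Inl\<close> and primes with \<^const>\<open>Inr\<close>, so a class size that happens to be prime yields
  two distinct vertices. As usual in \<^theory>\<open>Graph_Theory.Digraph\<close>, an undirected edge is a pair
  of opposite arcs.
\<close>

definition bipartite_divisor_graph :: "('a, 'm) monoid_scheme \<Rightarrow> (nat + nat) pair_pre_digraph" where
  "bipartite_divisor_graph G =
    (let E = {(Inl n, Inr p) | n p.
                n \<in> noncentral_class_sizes G \<and> p \<in> class_size_primes G \<and> gcd p n \<noteq> 1}
     in \<lparr> pverts = Inl ` noncentral_class_sizes G \<union> Inr ` class_size_primes G,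
          parcs = E \<union> E\<inverse> \<rparr>)"

end

theory Submission
  imports Defs "HOL-Algebra.Elementary_Groups" "HOL-Library.Numeral_Type" "HOL-Library.Countable"
begin

text \<open>
  Let \<open>T\<close> be the Heisenberg group over the field with three elements, extended by the involution
  that inverts it modulo its centre. A class of \<open>T\<close> has size 1 or 6 if it consists of even
  elements (those in the Heisenberg group), and size 9 if it consists of odd ones; the centralizer of
  an even noncentral element is even. Let \<open>C\<close> be an abelian group containing an involution
  \<open>\<zeta>\<close>, and let \<open>G\<close> be the central extension of \<open>T \<times> T\<close> by \<open>C\<close> in which odd elements of
  the first factor commute with odd elements of the second up to \<open>\<zeta>\<close>. An odd component whose partner is
  central or odd doubles the class; if the partner is even and noncentral, the power of \<open>\<zeta>\<close> is
  determined by the conjugate of that partner. So the class sizes of \<open>G\<close> are \<open>1\<close>, \<open>6\<close>,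
  \<open>6 * 6\<close>, \<open>2 * 9\<close>, \<open>9 * 6\<close> and \<open>2 * 9 * 9\<close>. Apart from 1, each is divisible by exactly the
  primes 2 and 3. Letting \<open>C\<close> run through the cyclic groups of even order gives infinitely many \<open>G\<close>.
\<close>

section \<open>The group \<open>T\<close> of order 54\<close>

type_synonym heis2 = "3 \<times> 3 \<times> 3 \<times> bool"

definition flip :: "bool \<Rightarrow> 3 \<Rightarrow> 3" where
  "flip s x = (if s then - x else x)"

text \<open>The alternating form \<open>x * y' - y * x'\<close> serves as Heisenberg cocycle;
  commutators of even elements are twice the form, hence not all trivial since 2 is invertible
  modulo 3. The flag marks the involution: it negates \<open>x\<close> and \<open>y\<close>, which
  leaves the form and \<open>z\<close> fixed.\<close>

fun heis2_mult :: "heis2 \<Rightarrow> heis2 \<Rightarrow> heis2" (infixl "\<star>" 70) where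
  "(x, y, z, s) \<star> (x', y', z', s') =
     (x + flip s x', y + flip s y', z + z' + flip s (x * y' - y * x'), s \<noteq> s')"

fun odd_part :: "heis2 \<Rightarrow> bool" where
  "odd_part (x, y, z, s) = s"

lemma heis2_assoc: "a \<star> b \<star> c = a \<star> (b \<star> c)"
  by (cases a; cases b; cases c) (auto simp: flip_def algebra_simps)

lemma heis2_one: "(0, 0, 0, False) \<star> a = a"
  by (cases a) (simp add: flip_def)

lemma heis2_inverse: "\<exists>b. b \<star> a = (0, 0, 0, False)"
proof (cases a)
  case (fields x y z s)
  then have "(- flip s x, - flip s y, - z, s) \<star> a = (0, 0, 0, False)"
    by (auto simp: flip_def algebra_simps)
  then show ?thesis by blast
qed

lemma odd_part_mult: "odd_part (a \<star> b) \<longleftrightarrow> odd_part a \<noteq> odd_part b"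
  by (cases a; cases b) auto

lemma F3_cases: "(x::3) = 0 \<or> x = 1 \<or> x = -1"
proof -
  have "card {0, 1, -1 :: 3} = card (UNIV :: 3 set)"
    by simp
  then have "{0, 1, -1 :: 3} = UNIV"
    by (intro card_subset_eq) auto
  then show ?thesis by blast
qed

lemma F3_square: "(x::3) \<noteq> 0 \<Longrightarrow> x * x = 1"
  using F3_cases[of x] by auto
lemma F3_neg: "(x::3) \<noteq> 0 \<Longrightarrow> x \<noteq> - x"
  using F3_cases[of x] by auto
lemma F3_double: "(x::3) + x = - x"
  using F3_cases[of x] by auto


section \<open>Conjugates in \<open>T\<close>, split by the parity of the conjugator\<close>

text \<open>
  The conjugates of \<open>g\<close> by elements of parity \<open>s\<close>, in a form that avoids inverses.
\<close>

definition conj_part :: "heis2 \<Rightarrow> bool \<Rightarrow> heis2 set" where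
  "conj_part g s = {y. \<exists>k. odd_part k = s \<and> y \<star> k = k \<star> g}"

text \<open>For a conjugator \<open>(p, q, r, s)\<close> the first two coordinates become
  \<open>2 * p + flip s x\<close> and \<open>2 * q + flip s y\<close>, which take every value for
  either parity because 2 is invertible. In the third coordinate \<open>r\<close> and all form terms
  cancel.\<close>

lemma conj_part_odd:
  "conj_part (x, y, z, True) s = UNIV \<times> UNIV \<times> {z} \<times> {True}"
proof (intro equalityI subsetI)
  fix u assume "u \<in> conj_part (x, y, z, True) s"
  then obtain p q r s' where k: "u \<star> (p, q, r, s') = (p, q, r, s') \<star> (x, y, z, True)"
    by (auto simp: conj_part_def)
  obtain a b c e where u: "u = (a, b, c, e)" by (cases u)
  have e: "e" using k unfolding u by (auto split: if_splits)
  have a: "a = p + p + flip s' x" and b: "b = q + q + flip s' y"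
    using k e unfolding u by (simp_all add: flip_def algebra_simps)
  have "c + r + flip e (a * q - b * p) = r + z + flip s' (p * y - q * x)"
    using k unfolding u by simp
  then have "c = z" using e unfolding a b by (cases s') (simp_all add: flip_def algebra_simps)
  with u e show "u \<in> UNIV \<times> UNIV \<times> {z} \<times> {True}" by simp
next
  fix u :: heis2 assume "u \<in> UNIV \<times> UNIV \<times> {z} \<times> {True}"
  then obtain a b :: 3 where u: "u = (a, b, z, True)" by auto
  \<comment> \<open>Solution of \<open>a = p + p + flip s x\<close>, using 2 = -1 modulo 3.\<close>
  define p q where "p = flip s x - a" and "q = flip s y - b"
  have ab: "a = p + p + flip s x" "b = q + q + flip s y"
    unfolding p_def q_def F3_double by simp_all
  have "u \<star> (p, q, 0, s) = (p, q, 0, s) \<star> (x, y, z, True)"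
    unfolding u ab by (simp add: flip_def algebra_simps)
  then show "u \<in> conj_part (x, y, z, True) s"
    unfolding conj_part_def using odd_part.simps by blast
qed

text \<open>The third coordinate moves by twice the form, and 2 = -1 turns this into a
  subtraction.\<close>

lemma conj_part_evenE:
  assumes "u \<in> conj_part (x, y, z, False) s"
  obtains p q where "u = (flip s x, flip s y, z - flip s (p * y - q * x), False)"
proof -
  obtain p q r where k: "u \<star> (p, q, r, s) = (p, q, r, s) \<star> (x, y, z, False)"
    using assms by (auto simp: conj_part_def)
  obtain a b c e where u: "u = (a, b, c, e)" by (cases u)
  have e: "\<not> e" using k unfolding u by (auto split: if_splits)
  have a: "a = flip s x" and b: "b = flip s y"
    using k e unfolding u by (simp_all add: flip_def algebra_simps)
  have "c = z + (flip s (p * y - q * x) + flip s (p * y - q * x))"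
    using k e unfolding u a b by (simp add: flip_def algebra_simps split: if_splits)
  then show ?thesis using that[of p q] u e a b by (simp add: F3_double)
qed

lemma conj_part_central: "conj_part (0, 0, z, False) s = {(0, 0, z, False)}"
proof (intro equalityI subsetI)
  fix u assume "u \<in> conj_part (0, 0, z, False) s"
  then show "u \<in> {(0, 0, z, False)}"
    by (rule conj_part_evenE) (simp add: flip_def)
next
  fix u :: heis2 assume "u \<in> {(0, 0, z, False)}"
  then have "u \<star> (0, 0, 0, s) = (0, 0, 0, s) \<star> (0, 0, z, False)"
    by (simp add: flip_def)
  then show "u \<in> conj_part (0, 0, z, False) s"
    unfolding conj_part_def using odd_part.simps by blast
qed

lemma conj_part_even:
  assumes "x \<noteq> 0 \<or> y \<noteq> 0"
  shows "conj_part (x, y, z, False) s = {flip s x} \<times> {flip s y} \<times> UNIV \<times> {False}"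
proof (intro equalityI subsetI)
  fix u assume "u \<in> conj_part (x, y, z, False) s"
  then show "u \<in> {flip s x} \<times> {flip s y} \<times> UNIV \<times> {False}"
    by (rule conj_part_evenE) simp
next
  fix u :: heis2 assume "u \<in> {flip s x} \<times> {flip s y} \<times> UNIV \<times> {False}"
  then obtain c :: 3 where u: "u = (flip s x, flip s y, c, False)" by auto
  \<comment> \<open>The value the form must take for the third coordinate to become
    \<open>c\<close>.\<close>
  define d where "d = flip s (z - c)"
  \<comment> \<open>A nonzero vector pairs onto the whole field; nonzero elements are their own
    inverses, so the witness is \<open>q = - d * x\<close> or \<open>p = d * y\<close>.\<close>
  obtain p q where d: "p * y - q * x = d"
  proof (cases "y = 0")
    case True
    then have "0 * y - (- d * x) * x = d" using assms F3_square[of x] by (simp add: mult.assoc)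
    then show ?thesis using that by blast
  next
    case False
    then have "d * y * y - 0 * x = d" by (simp add: F3_square mult.assoc)
    then show ?thesis using that by blast
  qed
  have c: "c = z + (flip s (p * y - q * x) + flip s (p * y - q * x))"
    unfolding d F3_double by (simp add: d_def flip_def)
  have "u \<star> (p, q, 0, s) = (p, q, 0, s) \<star> (x, y, z, False)"
    unfolding u c by (simp add: flip_def algebra_simps)
  then show "u \<in> conj_part (x, y, z, False) s"
    unfolding conj_part_def using odd_part.simps by blast
qed

text \<open>The only facts about \<open>T\<close> that the counting of classes uses. Disjointness in
  the even case expresses that the centralizer is even; equality in the odd case reflects that an
  odd element commutes with itself.\<close>

lemma conj_part_cases:
  obtains (central) "\<not> odd_part g" "\<And>s. conj_part g s = {g}"
  | (even) "\<not> odd_part g" "\<And>s. card (conj_part g s) = 3"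
      "conj_part g False \<inter> conj_part g True = {}"
  | (odd) "odd_part g" "conj_part g True = conj_part g False" "card (conj_part g False) = 9"
proof -
  obtain x y z s where g: "g = (x, y, z, s)" by (cases g)
  consider "s" | "\<not> s" "x = 0" "y = 0" | "\<not> s" "x \<noteq> 0 \<or> y \<noteq> 0" by blast
  then show ?thesis
  proof cases
    case 1
    then show ?thesis
      by (intro odd) (simp_all add: g conj_part_odd card_cartesian_product)
  next
    case 2
    then show ?thesis
      by (intro central) (simp_all add: g conj_part_central)
  next
    case 3
    \<comment> \<open>A nonzero coordinate differs from its negative, so it reveals the parity of
      the conjugator.\<close>
    then have "flip False x \<noteq> flip True x \<or> flip False y \<noteq> flip True y"
      using F3_neg[of x] F3_neg[of y] by (auto simp: flip_def)
    then have "conj_part g False \<inter> conj_part g True = {}"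
      using 3 unfolding g by (auto simp: conj_part_even)
    then show ?thesis
      using 3 by (intro even) (simp_all add: g conj_part_even card_cartesian_product)
  qed
qed

section \<open>Conjugacy classes in arbitrary groups\<close>

lemma (in group) conj_class_iff:
  assumes "g \<in> carrier G"
  shows "y \<in> conj_class G g \<longleftrightarrow> y \<in> carrier G \<and> (\<exists>k\<in>carrier G. y \<otimes> k = k \<otimes> g)"
proof -
  have "y = x \<otimes> g \<otimes> inv x \<longleftrightarrow> y \<in> carrier G \<and> y \<otimes> x = x \<otimes> g" if "x \<in> carrier G" for x
    using that assms by (metis inv_closed inv_solve_right m_closed)
  then show ?thesis by (auto simp: conj_class_def)
qed

lemma (in group) self_in_conj_class: "g \<in> carrier G \<Longrightarrow> g \<in> conj_class G g"
  by (auto simp: conj_class_iff)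

lemma (in group) centre_iff_card_conj_class:
  assumes "g \<in> carrier G"
  shows "g \<in> group_centre G \<longleftrightarrow> card (conj_class G g) = 1"
proof
  assume central: "g \<in> group_centre G"
  have "y \<otimes> k = k \<otimes> g \<longleftrightarrow> y = g" if "y \<in> carrier G" "k \<in> carrier G" for y k
  proof -
    have "k \<otimes> g = g \<otimes> k" using central that by (simp add: group_centre_def)
    then show ?thesis using that assms by simp
  qed
  then have "conj_class G g = {g}"
    using assms by (auto simp: conj_class_iff)
  then show "card (conj_class G g) = 1" by simp
next
  assume "card (conj_class G g) = 1"
  then obtain a where "conj_class G g = {a}" by (auto simp: card_1_singleton_iff)
  then have single: "conj_class G g = {g}" using self_in_conj_class[OF assms] by auto
  have "g \<otimes> x = x \<otimes> g" if x: "x \<in> carrier G" for x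
  proof -
    have "x \<otimes> g \<otimes> inv x \<in> conj_class G g" using x by (auto simp: conj_class_def)
    then have "x \<otimes> g \<otimes> inv x = g" using single by simp
    then show ?thesis using x assms by (metis inv_solve_right' m_closed)
  qed
  then show "g \<in> group_centre G" using assms by (simp add: group_centre_def)
qed

text \<open>Excluding the centre amounts to excluding size 1.\<close>

lemma (in group) noncentral_class_sizes_eq:
  "noncentral_class_sizes G = (\<lambda>g. card (conj_class G g)) ` carrier G - {1}"
  using centre_iff_card_conj_class by (fastforce simp: noncentral_class_sizes_def)

text \<open>Lets the sizes be computed on triples and then carried over to a copy on
  \<open>nat\<close>.\<close>

lemma noncentral_class_sizes_iso:
  assumes "group G" "group H" "h \<in> iso G H"
  shows "noncentral_class_sizes H = noncentral_class_sizes G"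
proof -
  interpret G: group G by fact
  interpret H: group H by fact
  have bij: "inj_on h (carrier G)" "h ` carrier G = carrier H" and hom: "h \<in> hom G H"
    using assms by (auto simp: iso_def bij_betw_def)
  interpret h: group_hom G H h
    by unfold_locales fact
  have "conj_class H (h g) = h ` conj_class G g" if "g \<in> carrier G" for g
    unfolding conj_class_def using that
    by (auto simp: image_iff bij(2)[symmetric]) (metis G.inv_closed G.m_closed h.hom_inv h.hom_mult)+
  moreover have "conj_class G g \<subseteq> carrier G" if "g \<in> carrier G" for g
    using that by (auto simp: G.conj_class_iff)
  ultimately have "card (conj_class H (h g)) = card (conj_class G g)" if "g \<in> carrier G" for g
    using that bij(1) by (metis card_image inj_on_subset)
  then show ?thesis
    unfolding G.noncentral_class_sizes_eq H.noncentral_class_sizes_eq bij(2)[symmetric] image_image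
    by simp
qed

section \<open>The central extension of \<open>T\<close> x \<open>T\<close> by
  \<open>C\<close>\<close>

text \<open>The factor is a bimultiplicative 2-cocycle in the two parities. Its asymmetry, first
  component on the left and second on the right, produces the commutator
  \<open>\<zeta>\<close>.\<close>

definition twisted_square ::
    "('c, 'm) monoid_scheme \<Rightarrow> 'c \<Rightarrow> (heis2 \<times> heis2 \<times> 'c) monoid" where
  "twisted_square C \<zeta> =
     \<lparr>carrier = UNIV \<times> UNIV \<times> carrier C,
      monoid.mult = \<lambda>(g, h, c) (g', h', c'). (g \<star> g', h \<star> h',
        c \<otimes>\<^bsub>C\<^esub> c' \<otimes>\<^bsub>C\<^esub> (if odd_part g \<and> odd_part h' then \<zeta> else \<one>\<^bsub>C\<^esub>)),
      one = ((0, 0, 0, False), (0, 0, 0, False), \<one>\<^bsub>C\<^esub>)\<rparr>"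

locale involution = comm_group C for C (structure) +
  fixes \<zeta>
  assumes closed [simp, intro]: "\<zeta> \<in> carrier C"
    and nontrivial: "\<zeta> \<noteq> \<one>"
    and square [simp]: "\<zeta> \<otimes> \<zeta> = \<one>"
begin

abbreviation "twist b \<equiv> (if b then \<zeta> else \<one>)"

lemma group_twisted_square: "group (twisted_square C \<zeta>)"
proof (rule groupI)
  fix x y z
  assume "x \<in> carrier (twisted_square C \<zeta>)" "y \<in> carrier (twisted_square C \<zeta>)"
    "z \<in> carrier (twisted_square C \<zeta>)"
  then obtain g1 h1 c1 g2 h2 c2 g3 h3 c3 where
    "x = (g1, h1, c1)" "y = (g2, h2, c2)" "z = (g3, h3, c3)"
    and c: "c1 \<in> carrier C" "c2 \<in> carrier C" "c3 \<in> carrier C"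
    by (cases x; cases y; cases z) (simp add: twisted_square_def)
  then show "x \<otimes>\<^bsub>twisted_square C \<zeta>\<^esub> y \<otimes>\<^bsub>twisted_square C \<zeta>\<^esub> z =
      x \<otimes>\<^bsub>twisted_square C \<zeta>\<^esub> (y \<otimes>\<^bsub>twisted_square C \<zeta>\<^esub> z)"
    by (simp add: twisted_square_def heis2_assoc odd_part_mult m_ac)
next
  fix x assume "x \<in> carrier (twisted_square C \<zeta>)"
  then obtain g h c where x: "x = (g, h, c)" "c \<in> carrier C"
    by (auto simp: twisted_square_def)
  obtain g' h' where "g' \<star> g = (0, 0, 0, False)" "h' \<star> h = (0, 0, 0, False)"
    using heis2_inverse by metis
  then show "\<exists>y\<in>carrier (twisted_square C \<zeta>). y \<otimes>\<^bsub>twisted_square C \<zeta>\<^esub> x = \<one>\<^bsub>twisted_square C \<zeta>\<^esub>"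
    using x
    \<comment> \<open>The third coordinate also has to cancel the twist created by multiplying with
      \<open>x\<close>.\<close>
    by (intro bexI[of _ "(g', h', inv (c \<otimes> twist (odd_part g' \<and> odd_part h)))"])
      (auto simp: twisted_square_def m_assoc)
qed (auto simp: twisted_square_def heis2_one)

text \<open>For a conjugator \<open>(k1, k2, e)\<close>, \<open>e\<close> cancels as
  \<open>C\<close> is abelian, so only the parities \<open>s\<close> and \<open>t\<close> of
  \<open>k1\<close> and \<open>k2\<close> affect the last coordinate. The two sides of
  \<open>y k = k (g, h, c)\<close> carry one twist each; these combine to an exclusive or, written
  as \<open>\<noteq>\<close>.\<close>

lemma conj_class_twisted_square:
  assumes c: "c \<in> carrier C"
  shows "conj_class (twisted_square C \<zeta>) (g, h, c) =
    (\<Union>s. \<Union>t. conj_part g s \<times> conj_part h t \<times>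
       {c \<otimes> twist ((odd_part g \<and> t) \<noteq> (s \<and> odd_part h))})"
    (is "_ = ?R")
proof -
  interpret G: group "twisted_square C \<zeta>" by (rule group_twisted_square)
  have cc: "(g, h, c) \<in> carrier (twisted_square C \<zeta>)"
    using c by (simp add: twisted_square_def)
  have odd_eq: "odd_part a = odd_part b" if "a \<star> k = k \<star> b" for a b k
    using odd_part_mult[of a k] odd_part_mult[of k b] that by auto
  have twist_swap: "d \<otimes> e \<otimes> twist (odd_part g \<and> t) = e \<otimes> c \<otimes> twist (s \<and> odd_part h) \<longleftrightarrow>
      d = c \<otimes> twist ((odd_part g \<and> t) \<noteq> (s \<and> odd_part h))"
    if "d \<in> carrier C" "e \<in> carrier C" for d e s t
  proof -
    have "d \<otimes> e \<otimes> twist (odd_part g \<and> t) = e \<otimes> (d \<otimes> twist (odd_part g \<and> t))"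
      "e \<otimes> c \<otimes> twist (s \<and> odd_part h) = e \<otimes> (c \<otimes> twist (s \<and> odd_part h))"
      using that c by (simp_all add: m_ac)
    \<comment> \<open>Each twist is its own inverse, so it can be moved across the equation.\<close>
    moreover have "d \<otimes> twist a = c \<otimes> twist b \<longleftrightarrow> d = c \<otimes> twist (a \<noteq> b)" for a b
    proof -
      have "d = d \<otimes> twist a \<otimes> twist a" using that by (simp add: m_assoc)
      moreover have "c \<otimes> twist (a \<noteq> b) = c \<otimes> twist b \<otimes> twist a"
        using c by (simp add: m_assoc)
      moreover have "d \<otimes> twist a \<in> carrier C" "c \<otimes> twist b \<in> carrier C" "twist a \<in> carrier C"
        using c that by simp_all
      ultimately show ?thesis by auto
    qed
    ultimately show ?thesis using that c by simp
  qed
  show ?thesis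
  proof (intro equalityI subsetI)
    fix y assume "y \<in> conj_class (twisted_square C \<zeta>) (g, h, c)"
    then obtain k where y: "y \<in> carrier (twisted_square C \<zeta>)" "k \<in> carrier (twisted_square C \<zeta>)"
      "y \<otimes>\<^bsub>twisted_square C \<zeta>\<^esub> k = k \<otimes>\<^bsub>twisted_square C \<zeta>\<^esub> (g, h, c)"
      using G.conj_class_iff[OF cc] by blast
    obtain a b d k1 k2 e where eqs: "y = (a, b, d)" "k = (k1, k2, e)"
      by (cases y; cases k)
    have de: "d \<in> carrier C" "e \<in> carrier C" and m: "a \<star> k1 = k1 \<star> g" "b \<star> k2 = k2 \<star> h"
      and "d \<otimes> e \<otimes> twist (odd_part a \<and> odd_part k2) = e \<otimes> c \<otimes> twist (odd_part k1 \<and> odd_part h)"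
      using y unfolding eqs by (simp_all add: twisted_square_def)
    then have "d = c \<otimes> twist ((odd_part g \<and> odd_part k2) \<noteq> (odd_part k1 \<and> odd_part h))"
      using odd_eq[OF m(1)] twist_swap[OF de] by simp
    then show "y \<in> ?R" using m unfolding eqs conj_part_def by blast
  next
    fix y assume "y \<in> ?R"
    then obtain a b k1 k2 where m: "a \<star> k1 = k1 \<star> g" "b \<star> k2 = k2 \<star> h"
      and y: "y = (a, b, c \<otimes> twist ((odd_part g \<and> odd_part k2) \<noteq> (odd_part k1 \<and> odd_part h)))"
      (is "y = (a, b, ?d)")
      by (auto simp: conj_part_def)
    have d: "?d \<in> carrier C" using c by simp
    have "?d \<otimes> \<one> \<otimes> twist (odd_part a \<and> odd_part k2) = \<one> \<otimes> c \<otimes> twist (odd_part k1 \<and> odd_part h)"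
      unfolding odd_eq[OF m(1)] twist_swap[OF d one_closed] ..
    then have "y \<otimes>\<^bsub>twisted_square C \<zeta>\<^esub> (k1, k2, \<one>) = (k1, k2, \<one>) \<otimes>\<^bsub>twisted_square C \<zeta>\<^esub> (g, h, c)"
      using m unfolding y by (simp add: twisted_square_def)
    moreover have "y \<in> carrier (twisted_square C \<zeta>)" "(k1, k2, \<one>) \<in> carrier (twisted_square C \<zeta>)"
      unfolding y using d by (simp_all add: twisted_square_def)
    ultimately show "y \<in> conj_class (twisted_square C \<zeta>) (g, h, c)"
      using G.conj_class_iff[OF cc] by blast
  qed
qed


section \<open>Class sizes of the extension\<close>

lemma twist_translate:
  assumes "c \<in> carrier C"
  shows "c \<otimes> \<zeta> \<noteq> c"
  using assms nontrivial by simp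

text \<open>With both components even no twist occurs and the class is a product. Otherwise it has
  two layers, over \<open>c\<close> and \<open>c \<otimes> \<zeta>\<close>. If just one component is
  odd, the layer is the parity of the conjugator of the even one, whose two sets of conjugates have
  equal size. If both are odd, all parities give the same conjugates and both layers are
  full.\<close>

lemma card_conj_class_twisted_square:
  assumes c: "c \<in> carrier C"
  shows "card (conj_class (twisted_square C \<zeta>) (g, h, c)) =
    (if odd_part g \<or> odd_part h
     then 2 * card (conj_part g False) * card (conj_part h False)
     else card (\<Union>s. conj_part g s) * card (\<Union>s. conj_part h s))"
    (is "card ?K = _")
proof -
  have card2: "card (A \<times> B \<times> {c} \<union> A' \<times> B' \<times> {c \<otimes> \<zeta>}) = card A * card B + card A' * card B'"
    if "finite A" "finite B" "finite A'" "finite B'"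
    for A A' :: "heis2 set" and B B' :: "heis2 set"
    using that twist_translate[OF c] by (subst card_Un_disjoint) (auto simp: card_cartesian_product)
  have K: "?K = (\<Union>s. \<Union>t. conj_part g s \<times> conj_part h t \<times>
      {c \<otimes> twist ((odd_part g \<and> t) \<noteq> (s \<and> odd_part h))})"
    using c by (rule conj_class_twisted_square)
  have odd_eq: "conj_part g True = conj_part g False" if "odd_part g" for g
    using that by (cases g rule: conj_part_cases) auto
  have card_eq: "card (conj_part g True) = card (conj_part g False)" for g
    by (cases g rule: conj_part_cases) auto
  consider "\<not> odd_part g" "\<not> odd_part h" | "odd_part g" "\<not> odd_part h"
    | "\<not> odd_part g" "odd_part h" | "odd_part g" "odd_part h" by blast
  then show ?thesis
  proof cases
    case 1
    then have "?K = (\<Union>s. conj_part g s) \<times> (\<Union>s. conj_part h s) \<times> {c}"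
      unfolding K using c by auto
    then show ?thesis using 1 by (simp add: card_cartesian_product)
  next
    case 2
    then have "?K = conj_part g False \<times> conj_part h False \<times> {c} \<union>
        conj_part g False \<times> conj_part h True \<times> {c \<otimes> \<zeta>}"
      unfolding K UNIV_bool using c odd_eq[of g] by auto
    then show ?thesis using 2 by (simp add: card2 card_eq)
  next
    case 3
    then have "?K = conj_part g False \<times> conj_part h False \<times> {c} \<union>
        conj_part g True \<times> conj_part h False \<times> {c \<otimes> \<zeta>}"
      unfolding K UNIV_bool using c odd_eq[of h] by auto
    then show ?thesis using 3 by (simp add: card2 card_eq)
  next
    case 4
    then have "?K = conj_part g False \<times> conj_part h False \<times> {c} \<union>
        conj_part g False \<times> conj_part h False \<times> {c \<otimes> \<zeta>}"
      unfolding K UNIV_bool using c odd_eq[of g] odd_eq[of h] by auto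
    then show ?thesis using 4 by (simp add: card2)
  qed
qed

lemma noncentral_class_sizes_twisted_square:
  "noncentral_class_sizes (twisted_square C \<zeta>) = {6, 18, 36, 54, 162}"
proof -
  \<comment> \<open>Parity, number of conjugates under elements of one parity, and full class size
    in \<open>T\<close>; by the preceding count, these determine the class size in the
    extension.\<close>
  define data where "data g = (odd_part g, card (conj_part g False), card (\<Union>s. conj_part g s))" for g
  define size where "size = (\<lambda>(a, m, k) (b, n, l). if a \<or> b then 2 * m * n else k * l :: nat)"
  have data_cases: "data g \<in> {(False, 1, 1), (False, 3, 6), (True, 9, 9)}" for g
    by (cases g rule: conj_part_cases) (auto simp: data_def UNIV_bool card_Un_disjoint)
  have "data (0, 0, 0, False) = (False, 1, 1)" "data (1, 0, 0, False) = (False, 3, 6)"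
    "data (0, 0, 0, True) = (True, 9, 9)"
    unfolding data_def UNIV_bool
    by (simp_all add: conj_part_central conj_part_even conj_part_odd card_cartesian_product)
     (subst card_Un_disjoint; auto simp: flip_def card_cartesian_product)
  then have "{(False, 1, 1), (False, 3, 6), (True, 9, 9)} \<subseteq> range data"
    by (metis empty_subsetI insert_subset rangeI)
  then have range: "range data = {(False, 1, 1), (False, 3, 6), (True, 9, 9)}"
    using data_cases by blast
  interpret G: group "twisted_square C \<zeta>" by (rule group_twisted_square)
  have "card (conj_class (twisted_square C \<zeta>) (g, h, c)) = size (data g) (data h)"
    if "c \<in> carrier C" for g h c
    using that by (simp add: card_conj_class_twisted_square size_def data_def)
  then have "(\<lambda>x. card (conj_class (twisted_square C \<zeta>) x)) ` carrier (twisted_square C \<zeta>) =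
      (\<lambda>(g, h, c). size (data g) (data h)) ` (UNIV \<times> UNIV \<times> carrier C)"
    by (intro image_cong) (auto simp: twisted_square_def)
  \<comment> \<open>The size ignores the coordinate in \<open>C\<close>, and
    \<open>one_closed\<close> supplies one for every pair.\<close>
  also have "\<dots> = (\<lambda>(u, v). size u v) ` (range data \<times> range data)"
    using one_closed by (auto simp: image_iff) blast+
  \<comment> \<open>Even pairs give 1, 6 and 36; an odd component gives 2 * 9 times 1, 3 or
    9.\<close>
  also have "\<dots> = {1, 6, 18, 36, 54, 162}"
    unfolding range by (auto simp: size_def image_iff)
  finally show ?thesis by (simp add: G.noncentral_class_sizes_eq insert_Diff_if)
qed

end

section \<open>From class sizes to the graph\<close>

lemma bipartite_divisor_graph_complete:
  assumes sizes: "noncentral_class_sizes G = {6, 18, 36, 54, 162}"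
  shows "complete_bipartite_digraph 2 5 (with_proj (bipartite_divisor_graph G))"
proof -
  have only: "p = 2 \<or> p = 3" if p: "prime p" "p dvd n" and n: "n \<in> {6, 18, 36, 54, 162}" for p n :: nat
  proof -
    \<comment> \<open>The exponent 4 is dictated by 162 = 2 * 3 ^ 4.\<close>
    have "n dvd (2 * 3) ^ 4" using n by auto
    then have "p dvd 2 * 3" using p prime_dvd_power dvd_trans by blast
    then have "p dvd 2 \<or> p dvd 3" using p(1) prime_dvd_mult_iff by blast
    then show ?thesis using p(1) by (auto simp: primes_dvd_imp_eq)
  qed
  have primes: "class_size_primes G = {2, 3}"
  proof (intro equalityI subsetI)
    show "p \<in> {2, 3}" if "p \<in> class_size_primes G" for p
      using that only unfolding class_size_primes_def sizes by blast
    show "p \<in> class_size_primes G" if "p \<in> {2, 3}" for p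
      using that unfolding class_size_primes_def sizes by auto
  qed
  have gcds: "gcd p n \<noteq> 1" if "n \<in> noncentral_class_sizes G" "p \<in> class_size_primes G" for p n
    using that unfolding sizes primes by auto
  define U V :: "(nat + nat) set"
    where "U = Inr ` class_size_primes G" and "V = Inl ` noncentral_class_sizes G"
  have verts: "pverts (bipartite_divisor_graph G) = U \<union> V"
    by (simp add: bipartite_divisor_graph_def Let_def U_def V_def Un_commute)
  have edges: "{(Inl n, Inr p) | n p.
      n \<in> noncentral_class_sizes G \<and> p \<in> class_size_primes G \<and> gcd p n \<noteq> 1} = V \<times> U"
    using gcds unfolding U_def V_def by blast
  have arcs: "parcs (bipartite_divisor_graph G) = U \<times> V \<union> V \<times> U"
    unfolding bipartite_divisor_graph_def Let_def edges by auto
  have "finite (U \<union> V)" "U \<inter> V = {}" "card U = 2" "card V = 5"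
    unfolding U_def V_def sizes primes by (simp_all add: card_image)
  then show ?thesis
    unfolding complete_bipartite_digraph_pair_def verts arcs by blast
qed

section \<open>An infinite family on the natural numbers\<close>

definition nat_copy :: "('a::countable, 'm) monoid_scheme \<Rightarrow> nat monoid" where
  "nat_copy G = \<lparr>carrier = to_nat ` carrier G,
     monoid.mult = \<lambda>a b. to_nat ((from_nat a :: 'a) \<otimes>\<^bsub>G\<^esub> from_nat b),
     one = to_nat \<one>\<^bsub>G\<^esub>\<rparr>"

lemma nat_copy:
  fixes G :: "('a::countable, 'm) monoid_scheme"
  assumes "group G"
  shows "group (nat_copy G)" "to_nat \<in> iso G (nat_copy G)"
proof -
  show iso: "to_nat \<in> iso G (nat_copy G)"
    by (auto simp: iso_def hom_def nat_copy_def bij_betw_def inj_on_subset[OF inj_to_nat])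
  \<comment> \<open>The image of a group under a homomorphism is a group, and the updated fields
    agree with those of \<open>nat_copy G\<close>.\<close>
  have "group (nat_copy G\<lparr>carrier := to_nat ` carrier G, one := to_nat \<one>\<^bsub>G\<^esub>\<rparr>)"
    using iso by (intro group.hom_imp_img_group assms) (simp add: iso_def)
  then show "group (nat_copy G)" by (simp add: nat_copy_def)
qed

text \<open>Half the modulus has order two. The successor keeps the modulus positive: modulus 0
  would give the infinite group of integers.\<close>

lemma involution_integer_mod_group: "involution (integer_mod_group (2 * Suc n)) (int (Suc n))"
proof -
  interpret comm_group "integer_mod_group (2 * Suc n)" by (rule abelian_integer_mod_group)
  show ?thesis
    by unfold_locales (auto simp: carrier_integer_mod_group)
qed

theorem theorem1p1:
  shows "\<exists>\<G> :: nat monoid set. infinite \<G> \<and>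
    (\<forall>G \<in> \<G>. group G \<and> finite (carrier G) \<and>
       complete_bipartite_digraph 2 5 (with_proj (bipartite_divisor_graph G))) \<and>
    pairwise (\<lambda>G H. \<not> G \<cong> H) \<G>"
proof -
  define \<Gamma> where
    "\<Gamma> n = nat_copy (twisted_square (integer_mod_group (2 * Suc n)) (int (Suc n)))" for n
  \<comment> \<open>The order, with 54 = 3 * 3 * 3 * 2 for each copy of \<open>T\<close>, grows with
    \<open>n\<close> and so tells the groups apart up to isomorphism.\<close>
  have G: "group (\<Gamma> n)" "finite (carrier (\<Gamma> n))" "card (carrier (\<Gamma> n)) = 54 * (54 * (2 * Suc n))"
    "complete_bipartite_digraph 2 5 (with_proj (bipartite_divisor_graph (\<Gamma> n)))" for n
  proof -
    interpret involution "integer_mod_group (2 * Suc n)" "int (Suc n)"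
      by (rule involution_integer_mod_group)
    note copy = nat_copy[OF group_twisted_square, folded \<Gamma>_def]
    show "group (\<Gamma> n)" by (rule copy)
    show "finite (carrier (\<Gamma> n))"
      by (simp add: \<Gamma>_def nat_copy_def twisted_square_def carrier_integer_mod_group)
    show "card (carrier (\<Gamma> n)) = 54 * (54 * (2 * Suc n))"
      by (simp add: \<Gamma>_def nat_copy_def twisted_square_def carrier_integer_mod_group
          card_image inj_on_subset[OF inj_to_nat] card_cartesian_product flip: UNIV_Times_UNIV)
    show "complete_bipartite_digraph 2 5 (with_proj (bipartite_divisor_graph (\<Gamma> n)))"
      using noncentral_class_sizes_iso[OF group_twisted_square copy]
        noncentral_class_sizes_twisted_square
      by (intro bipartite_divisor_graph_complete) simp
  qed
  have not_iso: "\<not> \<Gamma> m \<cong> \<Gamma> n" if "m \<noteq> n" for m n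
    using that iso_same_card[of "\<Gamma> m" "\<Gamma> n"] by (auto simp: G(3))
  have "inj \<Gamma>" using G(3) by (intro injI) (metis Suc_inject mult_left_cancel zero_neq_numeral)
  then have "infinite (range \<Gamma>)" by (rule range_inj_infinite)
  moreover have "pairwise (\<lambda>G H. \<not> G \<cong> H) (range \<Gamma>)"
    using not_iso by (auto simp: pairwise_def) metis
  ultimately show ?thesis using G by (intro exI[of _ "range \<Gamma>"]) blast
qed

end
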